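(* Consider the uncertain control system $\dot x(t) = g(x(t),u(t),w(t)) := f(x(t),w(t)) + G(x(t))u(t)$ with $f:\mathbb R^{n_x}\times\mathbb R^{n_w}\to\mathbb R^{n_x}$ and $G:\mathbb R^{n_x}\to\mathbb R^{n_x\times n_u}$, control set $U\subseteq\mathbb R^{n_u}$ and disturbance set $W\subseteq\mathbb R^{n_w}$. Assume that $U$ and $W$ are compact and convex, that $U$ has non-empty interior, that $f$ is jointly continuous in $(x,w)$ and locally Lipschitz-continuous in $x$, and that $G$ is continuously differentiable. Let $Y:[t_1,t_2]\to\mathbb K_C^{n_x}$ be a set-valued function such that (1) for every $c\in\mathbb R^{n_x}$, the function $t\mapsto V[Y(t)](c)$ is Lipschitz-continuous on $[t_1,t_2]$; and (2) for every $c\in\mathbb R^{n_x}$ and almost every $t\in[t_1,t_2]$, $$\dot V[Y(t)](c)\ \ge\ \min_{\nu\in U} V[\Gamma_g(\nu,c,Y(t))](c).$$ Then $Y$ is a robust forward invariant tube (RFIT) on $[t_1,t_2]$ for the system.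
   Context: $\mathbb K^{n}$ and $\mathbb K^{n}_C$ denote the compact, respectively compact convex, subsets of $\mathbb R^n$ (understood non-empty), and $\Pi(\mathbb R^n)$ is the power set of $\mathbb R^n$. The support function of a set $Z$ is $V[Z](c):=\max_z\{c^{\sf T}z\mid z\in Z\}$, $c\in\mathbb R^n$ (the same formula is used for compact $Z$). $\dot V[Y(t)](c)$ is the derivative with respect to $t$ of $t\mapsto V[Y(t)](c)$. For $\nu\in\mathbb R^{n_u}$, $c\in\mathbb R^{n_x}$, $Z\in\mathbb K_C^{n_x}$, $$\Gamma_g(\nu,c,Z):=\{g(\xi,\nu,\omega)\mid \xi\in Z,\ c^{\sf T}\xi=V[Z](c),\ \omega\in W\}.$$ $\mathbb W$ is the set of Lebesgue-integrable functions $w:\mathbb R\to\mathbb R^{n_w}$ with $w(t)\in W$ for all $t$. RFIT: a set-valued function $Y:[t_1,t_2]\to\Pi(\mathbb R^{n_x})$ is called a robust forward invariant tube for the system on $[t_1,t_2]$ if there exists an integrable feedback control law $\mu:[t_1,t_2]\times\mathbb R^{n_x}\to U$ such that any solution $x$ of the controlled system $\dot x(t)=f(x(t),w(t))+G(x(t))\mu(t,x(t))$, $t\in[t_1,t_2]$, with $x(t)\in Y(t)$ satisfies $x(t')\in Y(t')$, for all $t,t'\in[t_1,t_2]$ with $t'\ge t$ and all $w\in\mathbb W$.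
   Formalization: In (2) the exceptional null set of times is taken independent of c: for almost every t the derivative exists and the inequality holds for all c at once (with a separate null set for each c the claim fails); f is locally Lipschitz in x locally uniformly in w, and integrability is local. *)

theory Defs
  imports "HOL-Analysis.Analysis"
begin

(* For non-empty compact Z the supremum is attained, so it is the maximum of c \<bullet> z over Z. *)
definition support_fun :: "'a::euclidean_space set \<Rightarrow> 'a \<Rightarrow> real" where
  "support_fun Z c = (SUP z\<in>Z. c \<bullet> z)"

definition Gamma_set ::
  "('x::euclidean_space \<Rightarrow> 'u \<Rightarrow> 'w \<Rightarrow> 'x) \<Rightarrow> 'w set \<Rightarrow> 'u \<Rightarrow> 'x \<Rightarrow> 'x set \<Rightarrow> 'x set" where
  "Gamma_set g W \<nu> c Z = {g \<xi> \<nu> \<omega> | \<xi> \<omega>. \<xi> \<in> Z \<and> c \<bullet> \<xi> = support_fun Z c \<and> \<omega> \<in> W}"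

definition control_affine ::
  "(real^'nx \<Rightarrow> real^'nw \<Rightarrow> real^'nx) \<Rightarrow> (real^'nx \<Rightarrow> real^'nu^'nx) \<Rightarrow>
   real^'nx \<Rightarrow> real^'nu \<Rightarrow> real^'nw \<Rightarrow> real^'nx" where
  "control_affine f G x u w = f x w + G x *v u"

definition continuously_differentiable ::
  "('a::real_normed_vector \<Rightarrow> 'b::real_normed_vector) \<Rightarrow> bool" where
  "continuously_differentiable F \<longleftrightarrow>
     (\<exists>F'. (\<forall>x. (F has_derivative blinfun_apply (F' x)) (at x)) \<and> continuous_on UNIV F')"

definition locally_integrable_on ::
  "('a::euclidean_space \<Rightarrow> 'b::euclidean_space) \<Rightarrow> 'a set \<Rightarrow> bool" where
  "locally_integrable_on h S \<longleftrightarrow> (\<forall>K. compact K \<and> K \<subseteq> S \<longrightarrow> h absolutely_integrable_on K)"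

(* Integrability is local: if 0 is not in W, no W-valued function is integrable over the whole
   real line. *)
definition disturbances :: "(real^'nw) set \<Rightarrow> (real \<Rightarrow> real^'nw) set" where
  "disturbances W = {w. locally_integrable_on w UNIV \<and> (\<forall>t. w t \<in> W)}"

(* Caratheodory solutions in integral form: equivalently, x is absolutely continuous on [t1, t2]
   and satisfies x' = F t x for almost every t.  Needed because the right-hand side is only
   measurable in t and the feedback may be discontinuous in x. *)
definition solution_on ::
  "(real \<Rightarrow> 'a::euclidean_space \<Rightarrow> 'a) \<Rightarrow> real \<Rightarrow> real \<Rightarrow> (real \<Rightarrow> 'a) \<Rightarrow> bool" where
  "solution_on F t1 t2 x \<longleftrightarrow>
     (\<lambda>s. F s (x s)) absolutely_integrable_on {t1..t2} \<and>
     (\<forall>t\<in>{t1..t2}. x t = x t1 + integral {t1..t} (\<lambda>s. F s (x s)))"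

(* As for the disturbances, a feedback law on [t1, t2] \<times> R^nx is integrable in the local sense. *)
definition feedback_law ::
  "(real^'nu) set \<Rightarrow> real \<Rightarrow> real \<Rightarrow> (real \<Rightarrow> real^'nx \<Rightarrow> real^'nu) \<Rightarrow> bool" where
  "feedback_law U t1 t2 \<mu> \<longleftrightarrow>
     (\<forall>t\<in>{t1..t2}. \<forall>x. \<mu> t x \<in> U) \<and>
     locally_integrable_on (\<lambda>(t, x). \<mu> t x) ({t1..t2} \<times> UNIV)"

definition robust_forward_invariant_tube ::
  "(real^'nx \<Rightarrow> real^'nu \<Rightarrow> real^'nw \<Rightarrow> real^'nx) \<Rightarrow> (real^'nu) set \<Rightarrow> (real^'nw) set \<Rightarrow>
   real \<Rightarrow> real \<Rightarrow> (real \<Rightarrow> (real^'nx) set) \<Rightarrow> bool" where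
  "robust_forward_invariant_tube g U W t1 t2 Y \<longleftrightarrow>
     (\<exists>\<mu>. feedback_law U t1 t2 \<mu> \<and>
        (\<forall>w\<in>disturbances W. \<forall>x. solution_on (\<lambda>t y. g y (\<mu> t y) (w t)) t1 t2 x \<longrightarrow>
           (\<forall>t\<in>{t1..t2}. \<forall>t'\<in>{t1..t2}. t \<le> t' \<and> x t \<in> Y t \<longrightarrow> x t' \<in> Y t')))"

(* The derivative of the support function is required to exist; at interior times
   "at t within {t1..t2}" is the two-sided derivative.  The exceptional null set of times does not
   depend on c: with a null set for each c separately, a polytope could rotate with the flow so
   that each c is a facet normal only at finitely many times, and nothing would be required of the
   vector field in the interior of the facets.  The infimum over the compact set U is attained,
   because the supremum of c \<bullet> g over the Gamma set is continuous in \<nu>. *)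
definition min_max_differential_inequality ::
  "(real^'nx \<Rightarrow> real^'nu \<Rightarrow> real^'nw \<Rightarrow> real^'nx) \<Rightarrow> (real^'nu) set \<Rightarrow> (real^'nw) set \<Rightarrow>
   real \<Rightarrow> real \<Rightarrow> (real \<Rightarrow> (real^'nx) set) \<Rightarrow> bool" where
  "min_max_differential_inequality g U W t1 t2 Y \<longleftrightarrow>
     (AE t\<in>{t1..t2} in lebesgue. \<forall>c. \<exists>D.
        ((\<lambda>s. support_fun (Y s) c) has_real_derivative D) (at t within {t1..t2}) \<and>
        D \<ge> (INF \<nu>\<in>U. support_fun (Gamma_set g W \<nu> c (Y t)) c))"

end

(* Let p be the projection of x(t) on Y(t), n = x(t) - p, and phi = |n| the distance to the tube.
   Since phi(r) |n| >= n . x(r) - V[Y(r)](n) for all r, with equality at r = t, the left difference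
   quotients of phi at t are controlled by n . x' - (d/dt) V[Y(t)](n) alone.  The point p lies in the
   face of Y(t) with normal n, so the differential inequality says that a control minimising
   n . G(p) u makes this at most C |n|^2, the error from evaluating f and G at x instead of p.
   Hence D^- phi <= C phi for almost all t.  As V[Y(.)](c) is Lipschitz only for each c separately,
   phi need not be absolutely continuous; but D^- phi is finite at every t with phi(t) > 0, and that
   suffices for a comparison argument, so phi stays 0.  The control is a regularised
   minimiser, which avoids a measurable selection and is continuous outside the tube. *)
theory Submission
  imports Defs
begin

section \<open>A comparison theorem for left Dini derivatives\<close>

text \<open>Cover \<open>N\<close> by open sets \<open>V n\<close> of measure at most
  \<open>\<eta> * (1/2) ^ Suc n\<close> and add up the functions measuring the part of
  \<open>V n\<close> to the left of \<open>s\<close>. Near a point of \<open>N\<close> each summand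
  has slope 1, so the first \<open>k\<close> of them already give slope \<open>k\<close>, while the
  geometric series keeps the total below \<eta>.\<close>

lemma negligible_steep_function:
  fixes N :: "real set"
  assumes N: "negligible N" and "\<eta> > 0"
  obtains \<sigma> :: "real \<Rightarrow> real" where "mono \<sigma>" "\<And>s. 0 \<le> \<sigma> s" "\<And>s. \<sigma> s \<le> \<eta>"
    "\<And>s K. s \<in> N \<Longrightarrow> \<forall>\<^sub>F r in at_left s. K * (s - r) \<le> \<sigma> s - \<sigma> r"
proof -
  have "\<exists>V. open V \<and> N \<subseteq> V \<and> V \<in> lmeasurable \<and> measure lebesgue V \<le> \<eta> * (1/2) ^ Suc n" for n
  proof -
    have pos: "\<eta> * (1/2) ^ Suc n > 0" using \<open>\<eta> > 0\<close> by simp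
    obtain V where V: "open V" "N \<subseteq> V" "V - N \<in> lmeasurable"
      "emeasure lebesgue (V - N) < ennreal (\<eta> * (1/2) ^ Suc n)"
      using sets_lebesgue_outer_open[OF negligible_imp_sets[OF N] pos] by blast
    have null: "N \<in> null_sets lebesgue"
      using N by (simp add: negligible_iff_null_sets)
    have "emeasure lebesgue V = emeasure lebesgue (V - N)"
      using V(1) null by (simp add: emeasure_Diff_null_set)
    then have *: "emeasure lebesgue V < ennreal (\<eta> * (1/2) ^ Suc n)"
      using V(4) by simp
    then have "V \<in> lmeasurable"
      using V(1) by (auto intro!: fmeasurableI) (metis ennreal_less_top less_trans)
    moreover have "measure lebesgue V \<le> \<eta> * (1/2) ^ Suc n"
      unfolding measure_def using * pos by (intro enn2real_leI) (auto simp del: power_Suc)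
    ultimately show ?thesis using V by blast
  qed
  then obtain V where V: "\<And>n::nat. open (V n)" "\<And>n. N \<subseteq> V n" "\<And>n. V n \<in> lmeasurable"
      "\<And>n. measure lebesgue (V n) \<le> \<eta> * (1/2) ^ Suc n"
    by metis
  define m where "m n s = measure lebesgue (V n \<inter> {..s})" for n s
  have meas: "V n \<inter> {..s} \<in> lmeasurable" for n s
    using V(3)[of n] by (intro fmeasurable_Int_fmeasurable) auto
  have m_nonneg: "0 \<le> m n s" for n s by (simp add: m_def)
  have m_le: "m n s \<le> \<eta> * (1/2) ^ Suc n" for n s
    unfolding m_def
    by (rule order_trans[OF measure_mono_fmeasurable V(4)]) (use V(3) meas in \<open>auto simp: fmeasurableD\<close>)
  have m_mono: "m n r \<le> m n s" if "r \<le> s" for n r s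
    unfolding m_def by (rule measure_mono_fmeasurable) (use that meas in \<open>auto simp: fmeasurableD\<close>)
  have geo: "(\<lambda>n. \<eta> * (1/2) ^ Suc n) sums \<eta>"
    using sums_mult[OF power_half_series, of \<eta>] by simp
  have summ: "summable (\<lambda>n. m n s)" for s
    by (rule summable_comparison_test'[of "\<lambda>n. \<eta> * (1/2) ^ Suc n" 0])
      (use geo m_le m_nonneg in \<open>auto simp: sums_iff\<close>)
  define \<sigma> where "\<sigma> s = (\<Sum>n. m n s)" for s
  show ?thesis
  proof
    show "mono \<sigma>" by (auto intro!: monoI suminf_le summ m_mono simp: \<sigma>_def)
    show "0 \<le> \<sigma> s" for s by (auto intro!: suminf_nonneg summ m_nonneg simp: \<sigma>_def)
    show "\<sigma> s \<le> \<eta>" for s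
      using suminf_le[OF m_le summ sums_summable[OF geo]] geo by (simp add: \<sigma>_def sums_iff)
    show "\<forall>\<^sub>F r in at_left s. K * (s - r) \<le> \<sigma> s - \<sigma> r" if "s \<in> N" for s K
    proof -
      obtain k :: nat where k: "K \<le> k" using real_arch_simple by blast
      have "open (\<Inter>n<k. V n)" using V(1) by (intro open_INT) auto
      moreover have "s \<in> (\<Inter>n<k. V n)" using V(2) that by auto
      ultimately obtain e where e: "e > 0" "ball s e \<subseteq> (\<Inter>n<k. V n)"
        by (meson open_contains_ball)
      have "\<forall>\<^sub>F r in at_left s. r \<in> {s - e<..<s}"
        by (rule eventually_at_leftI[of "s - e"]) (use e in auto)
      then show ?thesis
      proof (rule eventually_mono)
        fix r assume r: "r \<in> {s - e<..<s}"
        have step: "s - r \<le> m n s - m n r" if "n < k" for n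
        proof -
          have sub: "{r<..s} \<subseteq> V n"
            using e that r by (force simp: dist_real_def subset_eq)
          have "V n \<inter> {..s} = (V n \<inter> {..r}) \<union> {r<..s}" using sub r by auto
          moreover have disjoint: "V n \<inter> {..r} \<inter> {r<..s} = {}" by auto
          have "measure lebesgue ((V n \<inter> {..r}) \<union> {r<..s}) = m n r + measure lebesgue {r<..s}"
            unfolding m_def using meas[of n r]
            by (subst measure_Un3) (auto simp: bounded_set_imp_lmeasurable disjoint)
          ultimately show ?thesis using r by (simp add: m_def)
        qed
        have "K * (s - r) \<le> k * (s - r)" using k r by (intro mult_right_mono) auto
        also have "\<dots> = (\<Sum>n<k. s - r)" by simp
        also have "\<dots> \<le> (\<Sum>n<k. m n s - m n r)" by (intro sum_mono step) auto
        also have "\<dots> \<le> (\<Sum>n. m n s - m n r)"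
          by (rule sum_le_suminf) (use r in \<open>auto intro!: summable_diff summ m_mono\<close>)
        also have "\<dots> = \<sigma> s - \<sigma> r"
          unfolding \<sigma>_def using suminf_diff[OF summ summ] by simp
        finally show "K * (s - r) \<le> \<sigma> s - \<sigma> r" .
      qed
    qed
  qed
qed

lemma at_left_le_at_within:
  fixes s :: real
  assumes "s \<in> {a<..b}"
  shows "at_left s \<le> at s within {a..b}"
proof -
  have "at_left s = at s within {a..s}" using assms by (simp add: at_within_Icc_at_left)
  also have "\<dots> \<le> at s within {a..b}" by (rule at_le) (use assms in auto)
  finally show ?thesis .
qed

text \<open>On the null set \<open>N\<close> only finiteness of the left Dini derivative is known,
  so \<psi> cannot simply be integrated. It is compared with a small positive barrier instead: just
  left of a first contact \<psi> lies strictly below the barrier, so there it grows strictly more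
  than the barrier, yet the barrier is built to grow at least as fast as \<psi> at every such point.
  Then \<eta> tends to 0.\<close>

lemma nonpos_if_left_Dini_le:
  fixes \<psi> :: "real \<Rightarrow> real"
  assumes cont: "continuous_on {a..b} \<psi>" and "a \<le> b" and a0: "\<psi> a \<le> 0"
    and N: "negligible N" and L: "L > 0"
    and finite: "\<And>s. s \<in> {a<..b} \<Longrightarrow> \<psi> s > 0 \<Longrightarrow> \<exists>K. \<forall>\<^sub>F r in at_left s. \<psi> s - \<psi> r \<le> K * (s - r)"
    and ae: "\<And>s. s \<in> {a<..b} \<Longrightarrow> s \<notin> N \<Longrightarrow> \<psi> s > 0 \<Longrightarrow>
               \<forall>\<^sub>F r in at_left s. \<psi> s - \<psi> r \<le> L * \<psi> s * (s - r)"
  shows "\<psi> b \<le> 0"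
proof -
  have bound: "\<psi> b \<le> exp (2 * L * (b - a)) * (2 * \<eta>)" if "\<eta> > 0" for \<eta>
  proof -
    obtain \<sigma> where \<sigma>: "mono \<sigma>" "\<And>s. 0 \<le> \<sigma> s" "\<And>s. \<sigma> s \<le> \<eta>"
      "\<And>s K. s \<in> N \<Longrightarrow> \<forall>\<^sub>F r in at_left s. K * (s - r) \<le> \<sigma> s - \<sigma> r"
      using negligible_steep_function[OF N \<open>\<eta> > 0\<close>] by blast
    \<comment> \<open>A barrier that outgrows \<open>\<psi>\<close> to the left of every point: through \<open>exp\<close> off \<open>N\<close>, through \<open>\<sigma>\<close> on \<open>N\<close>.\<close>
    define B where "B s = exp (2 * L * (s - a)) * (\<eta> + \<sigma> s)" for s
    have B_pos: "B s > 0" for s using \<sigma>(2)[of s] \<open>\<eta> > 0\<close> by (simp add: B_def add_pos_nonneg)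
    have B_mono: "B r \<le> B s" if "r \<le> s" for r s
      unfolding B_def using that L \<sigma>(2) \<open>\<eta> > 0\<close> monoD[OF \<sigma>(1)] by (intro mult_mono) (auto simp: add_nonneg_nonneg less_imp_le)
    have "\<psi> s < B s" if "s \<in> {a..b}" for s
    proof (rule ccontr)
      assume "\<not> \<psi> s < B s"
      define S where "S = {s \<in> {a..b}. B s \<le> \<psi> s}"
      define s0 where "s0 = Inf S"
      have "s \<in> S" using that \<open>\<not> \<psi> s < B s\<close> by (simp add: S_def)
      have bdd: "bdd_below S" by (rule bdd_belowI[of _ a]) (simp add: S_def)
      have low: "s0 \<le> r" if "r \<in> S" for r
        unfolding s0_def by (rule cInf_lower[OF that bdd])
      have "s0 \<in> closure S"
        unfolding s0_def by (rule closure_contains_Inf) (use \<open>s \<in> S\<close> bdd in auto)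
      have s0_in: "s0 \<in> {a..b}"
      proof -
        have "S \<subseteq> {a..b}" by (auto simp: S_def)
        then have "closure S \<subseteq> {a..b}" by (rule closure_minimal) simp
        then show ?thesis using \<open>s0 \<in> closure S\<close> by blast
      qed
      \<comment> \<open>\<open>S\<close> is not known to be closed, since only monotonicity of
        \<open>B\<close> is at hand. But \<open>s0\<close> lies below all of \<open>S\<close>, so
        \<open>\<psi> r \<ge> B s0\<close> holds on \<open>S\<close>; this bound is constant in
        \<open>r\<close> and passes to the closure.\<close>
      have ge: "B s0 \<le> \<psi> s0"
      proof -
        have "closed {r \<in> {a..b}. \<psi> r \<in> {B s0..}}"
          by (rule continuous_closed_preimage[OF cont, unfolded vimage_def Int_def mem_Collect_eq]) auto
        moreover have "S \<subseteq> {r \<in> {a..b}. \<psi> r \<in> {B s0..}}"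
          using low B_mono by (force simp: S_def)
        ultimately show ?thesis using \<open>s0 \<in> closure S\<close> closure_minimal by blast
      qed
      then have \<psi>_pos: "\<psi> s0 > 0" using B_pos[of s0] by linarith
      then have "s0 \<noteq> a" using a0 by auto
      then have s0: "s0 \<in> {a<..b}" using s0_in by auto
      have ev: "\<forall>\<^sub>F r in at_left s0. r \<in> {a<..<s0}"
        by (rule eventually_at_leftI[of a]) (use s0 in auto)
      have less: "\<psi> r < B r" if "r \<in> {a<..<s0}" for r
        using low[of r] that s0 by (force simp: S_def)
      have "(\<psi> \<longlongrightarrow> \<psi> s0) (at_left s0)"
        using cont s0_in at_left_le_at_within[OF s0] by (auto simp: continuous_on_def intro: tendsto_mono)
      then have "\<psi> s0 \<le> B s0"
      proof (rule tendsto_upperbound)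
        show "\<forall>\<^sub>F r in at_left s0. \<psi> r \<le> B s0"
          using ev
        proof (rule eventually_mono)
          fix r assume r: "r \<in> {a<..<s0}"
          show "\<psi> r \<le> B s0" using less[OF r] B_mono[of r s0] r by simp
        qed
      qed simp
      then have eq: "\<psi> s0 = B s0" using ge by simp
      have "\<forall>\<^sub>F r in at_left s0. \<psi> s0 - \<psi> r \<le> B s0 - B r"
      proof (cases "s0 \<in> N")
        case True
        obtain K where K: "\<forall>\<^sub>F r in at_left s0. \<psi> s0 - \<psi> r \<le> K * (s0 - r)"
          using finite[OF s0 \<psi>_pos] by blast
        show ?thesis using K \<sigma>(4)[OF True, of "max K 0"] ev
        proof eventually_elim
          case (elim r)
          have "\<psi> s0 - \<psi> r \<le> max K 0 * (s0 - r)"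
            using elim(1,3) by (smt (verit) mult_right_mono max.cobounded1 greaterThanLessThan_iff)
          also have "\<dots> \<le> \<sigma> s0 - \<sigma> r" by (rule elim(2))
          also have "\<dots> \<le> exp (2 * L * (s0 - a)) * (\<sigma> s0 - \<sigma> r)"
            using elim(3) s0 L monoD[OF \<sigma>(1), of r s0]
            by (simp add: mult_le_cancel_right1)
          also have "\<dots> = B s0 - exp (2 * L * (s0 - a)) * (\<eta> + \<sigma> r)"
            by (simp add: B_def algebra_simps)
          also have "\<dots> \<le> B s0 - B r"
            unfolding B_def using elim(3) L \<sigma>(2)[of r] \<open>\<eta> > 0\<close>
            by (intro diff_left_mono mult_right_mono) auto
          finally show ?case .
        qed
      next
        case False
        \<comment> \<open>The rate \<open>2 * L\<close> in \<open>B\<close> leaves a factor 2 to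
          spare. This window makes \<open>y = 2 * L * (s0 - r)\<close> at most 1, where
          \<open>exp (- y) \<le> 1 - y / 2\<close>; hence \<open>B\<close> drops from
          \<open>s0\<close> to \<open>r\<close> by at least \<open>L * B s0 * (s0 - r)\<close>, the
          bound assumed for \<psi>.\<close>
        have near: "\<forall>\<^sub>F r in at_left s0. s0 - 1 / (2 * L) < r"
          by (rule eventually_at_leftI[of "s0 - 1 / (2 * L)"]) (use L in auto)
        show ?thesis using ae[OF s0 False \<psi>_pos] near ev
        proof eventually_elim
          case (elim r)
          define y where "y = 2 * L * (s0 - r)"
          have y: "0 \<le> y" "y \<le> 1"
            using elim L by (auto simp: y_def field_simps)
          have "(1 - y / 2) * exp y \<ge> 1"
          proof -
            have "(1 - y / 2) * (1 + y) \<ge> 1" using y by (simp add: algebra_simps) (metis mult_left_le)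
            also have "(1 - y / 2) * (1 + y) \<le> (1 - y / 2) * exp y"
              using y by (intro mult_left_mono) auto
            finally show ?thesis .
          qed
          then have "exp (- y) \<le> 1 - y / 2"
            by (simp add: exp_minus field_simps)
          then have "exp (- y) * B s0 \<le> (1 - y / 2) * B s0"
            using B_pos[of s0] by (intro mult_right_mono) auto
          moreover have "B r \<le> exp (- y) * B s0"
          proof -
            have "B r \<le> exp (2 * L * (r - a)) * (\<eta> + \<sigma> s0)"
              unfolding B_def using monoD[OF \<sigma>(1), of r s0] elim(3) by (intro mult_left_mono) auto
            also have "\<dots> = exp (- y) * B s0"
              by (simp add: B_def y_def algebra_simps flip: exp_add)
            finally show ?thesis .
          qed
          ultimately have "B r \<le> (1 - y / 2) * B s0" by linarith
          moreover have "y / 2 = L * (s0 - r)" by (simp add: y_def)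
          ultimately have "L * B s0 * (s0 - r) \<le> B s0 - B r"
            by (simp add: algebra_simps)
          then show ?case using elim(1) eq by simp
        qed
      qed
      with ev have "\<forall>\<^sub>F r in at_left s0. False"
      proof eventually_elim
        case (elim r)
        then show False using less[of r] eq by simp
      qed
      then show False by simp
    qed
    then have "\<psi> b < B b" using \<open>a \<le> b\<close> by simp
    also have "B b \<le> exp (2 * L * (b - a)) * (2 * \<eta>)"
      unfolding B_def using \<sigma>(3)[of b] by (intro mult_left_mono) auto
    finally show ?thesis by simp
  qed
  show ?thesis
  proof (rule ccontr)
    assume "\<not> \<psi> b \<le> 0"
    \<comment> \<open>For this \<eta> the bound reads
      \<open>\<psi> b \<le> \<psi> b / 2\<close>.\<close>
    then show False using bound[of "\<psi> b / (4 * exp (2 * L * (b - a)))"] by simp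
  qed
qed

section \<open>Support functions and metric projections\<close>

lemma support_fun_upper:
  assumes "bounded Z" "z \<in> Z"
  shows "c \<bullet> z \<le> support_fun Z c"
  unfolding support_fun_def
  by (rule cSUP_upper[OF \<open>z \<in> Z\<close>])
    (use bounded_inner_imp_bdd_above[OF \<open>bounded Z\<close>, of c] in \<open>simp add: inner_commute\<close>)

lemma support_fun_least:
  assumes "Z \<noteq> {}" "\<And>z. z \<in> Z \<Longrightarrow> c \<bullet> z \<le> b"
  shows "support_fun Z c \<le> b"
  unfolding support_fun_def by (rule cSUP_least) (use assms in auto)

text \<open>This is the variational inequality of the projection: the projection lies in the face
  exposed by the outward normal, which makes it an admissible point in
  \<open>Gamma_set\<close>.\<close>

lemma support_fun_closest_point:
  assumes "compact Z" "convex Z" "Z \<noteq> {}"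
  shows "support_fun Z (x - closest_point Z x) = (x - closest_point Z x) \<bullet> closest_point Z x"
proof (rule antisym)
  show "support_fun Z (x - closest_point Z x) \<le> (x - closest_point Z x) \<bullet> closest_point Z x"
  proof (rule support_fun_least[OF assms(3)])
    fix z assume "z \<in> Z"
    then show "(x - closest_point Z x) \<bullet> z \<le> (x - closest_point Z x) \<bullet> closest_point Z x"
      using closest_point_dot[of Z z x] assms by (simp add: compact_imp_closed inner_diff_right)
  qed
  show "(x - closest_point Z x) \<bullet> closest_point Z x \<le> support_fun Z (x - closest_point Z x)"
    using assms by (intro support_fun_upper compact_imp_bounded closest_point_in_set compact_imp_closed)
qed

text \<open>For the converse, the direction \<open>c = z - closest_point Z z\<close> separates:
  testing with it gives \<open>c \<bullet> c \<le> 0\<close>.\<close>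

lemma mem_iff_support_fun:
  assumes "compact Z" "convex Z" "Z \<noteq> {}"
  shows "z \<in> Z \<longleftrightarrow> (\<forall>c. c \<bullet> z \<le> support_fun Z c)"
proof
  assume R: "\<forall>c. c \<bullet> z \<le> support_fun Z c"
  have "(z - closest_point Z z) \<bullet> (z - closest_point Z z) \<le> 0"
    using R[rule_format, of "z - closest_point Z z"] support_fun_closest_point[OF assms, of z]
    by (simp add: inner_diff_right)
  then have "z = closest_point Z z"
    by (metis inner_gt_zero_iff linorder_not_less right_minus_eq)
  then show "z \<in> Z"
    by (metis assms(1,3) closest_point_in_set compact_imp_closed)
qed (use assms in \<open>auto intro!: support_fun_upper compact_imp_bounded\<close>)

text \<open>The projection is expressed through non-strict inequalities between values of the
  support function, so that continuity of the latter makes the graph of the projection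
  closed.\<close>

lemma eq_closest_point_iff_support_fun:
  assumes "compact Z" "convex Z" "Z \<noteq> {}"
  shows "q = closest_point Z x \<longleftrightarrow>
    (\<forall>c. c \<bullet> q \<le> support_fun Z c) \<and> support_fun Z (x - q) \<le> (x - q) \<bullet> q"
proof
  assume "q = closest_point Z x"
  then show "(\<forall>c. c \<bullet> q \<le> support_fun Z c) \<and> support_fun Z (x - q) \<le> (x - q) \<bullet> q"
    using support_fun_closest_point[OF assms, of x] mem_iff_support_fun[OF assms, of q] assms
    by (simp add: closest_point_in_set compact_imp_closed)
next
  assume R: "(\<forall>c. c \<bullet> q \<le> support_fun Z c) \<and> support_fun Z (x - q) \<le> (x - q) \<bullet> q"
  then have "q \<in> Z" using mem_iff_support_fun[OF assms] by blast
  moreover have "dist x q \<le> dist x z" if "z \<in> Z" for z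
  proof -
    have "(x - q) \<bullet> (z - q) \<le> 0"
      using R support_fun_upper[OF compact_imp_bounded[OF assms(1)] that, of "x - q"]
      by (simp add: inner_diff_right)
    moreover have "(x - z) \<bullet> (x - z) = (x - q) \<bullet> (x - q) - 2 * ((x - q) \<bullet> (z - q)) + (z - q) \<bullet> (z - q)"
      by (simp add: inner_diff_left inner_diff_right inner_commute)
    ultimately have "(x - q) \<bullet> (x - q) \<le> (x - z) \<bullet> (x - z)"
      using inner_ge_zero[of "z - q"] by linarith
    then show ?thesis by (simp add: dist_norm norm_le)
  qed
  ultimately show "q = closest_point Z x"
    using assms by (intro closest_point_unique) (auto simp: compact_imp_closed)
qed

lemma support_fun_diff_le:
  assumes "Z \<subseteq> cball 0 R" "Z \<noteq> {}"
  shows "\<bar>support_fun Z c - support_fun Z c'\<bar> \<le> R * norm (c - c')"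
proof -
  have bdd: "bounded Z" using assms(1) bounded_cball bounded_subset by blast
  have "support_fun Z c \<le> support_fun Z c' + R * norm (c - c')" for c c'
  proof (rule support_fun_least[OF assms(2)])
    fix z assume z: "z \<in> Z"
    have "c \<bullet> z = c' \<bullet> z + (c - c') \<bullet> z" by (simp add: inner_diff_left)
    also have "(c - c') \<bullet> z \<le> norm (c - c') * norm z" by (rule norm_cauchy_schwarz)
    also have "\<dots> \<le> norm (c - c') * R" using z assms(1) by (intro mult_left_mono) auto
    finally show "c \<bullet> z \<le> support_fun Z c' + R * norm (c - c')"
      using support_fun_upper[OF bdd z, of c'] by (simp add: mult.commute)
  qed
  from this[of c c'] this[of c' c] show ?thesis by (simp add: norm_minus_commute abs_le_iff)
qed

section \<open>Joint continuity of support function and projection for a moving set\<close>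

context
  fixes T :: "'t::euclidean_space set" and Y :: "'t \<Rightarrow> 'a::euclidean_space set"
  assumes T: "compact T"
    and Y: "\<And>t. t \<in> T \<Longrightarrow> compact (Y t) \<and> convex (Y t) \<and> Y t \<noteq> {}"
    and cont: "\<And>c. continuous_on T (\<lambda>t. support_fun (Y t) c)"
begin

text \<open>The finitely many directions \<open>b\<close> and \<open>- b\<close> with
  \<open>b\<close> in \<open>Basis\<close> control all coordinates, and a finite sum of continuous
  functions is bounded on the compact \<open>T\<close>.\<close>

lemma uniformly_bounded_if_support_fun_continuous:
  obtains R where "R > 0" "\<And>t. t \<in> T \<Longrightarrow> Y t \<subseteq> cball 0 R"
proof -
  define h where "h t = (\<Sum>b\<in>Basis. \<bar>support_fun (Y t) b\<bar> + \<bar>support_fun (Y t) (- b)\<bar>)" for t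
  have "continuous_on T h" unfolding h_def by (intro continuous_intros cont)
  then have "bounded (h ` T)"
    by (intro compact_imp_bounded compact_continuous_image T)
  then obtain R where R: "R > 0" "\<And>t. t \<in> T \<Longrightarrow> norm (h t) \<le> R"
    by (auto simp: bounded_pos)
  show ?thesis
  proof (rule that[OF R(1)], rule subsetI)
    fix t z assume t: "t \<in> T" and z: "z \<in> Y t"
    have "norm z \<le> (\<Sum>b\<in>Basis. \<bar>z \<bullet> b\<bar>)" by (rule norm_le_l1)
    also have "\<dots> \<le> h t"
      unfolding h_def
    proof (rule sum_mono)
      fix b :: 'a
      have "b \<bullet> z \<le> support_fun (Y t) b" "- b \<bullet> z \<le> support_fun (Y t) (- b)"
        using Y[OF t] z by (auto intro!: support_fun_upper compact_imp_bounded simp flip: inner_minus_left)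
      then show "\<bar>z \<bullet> b\<bar> \<le> \<bar>support_fun (Y t) b\<bar> + \<bar>support_fun (Y t) (- b)\<bar>"
        by (simp add: inner_commute)
    qed
    also have "\<dots> \<le> R" using R(2)[OF t] by simp
    finally show "z \<in> cball 0 R" by simp
  qed
qed

text \<open>Continuity in \<open>t\<close> is given for each direction separately. It becomes joint
  because the support functions are Lipschitz in the direction with a constant \<open>R\<close>
  common to all \<open>t\<close>.\<close>

lemma continuous_on_support_fun_joint:
  "continuous_on (T \<times> UNIV) (\<lambda>z. support_fun (Y (fst z)) (snd z))"
proof -
  obtain R where R: "R > 0" "\<And>t. t \<in> T \<Longrightarrow> Y t \<subseteq> cball 0 R"
    using uniformly_bounded_if_support_fun_continuous by blast
  show ?thesis
    unfolding continuous_on_def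
  proof
    fix z0 :: "'t \<times> 'a" assume z0: "z0 \<in> T \<times> UNIV"
    let ?F = "at z0 within T \<times> UNIV"
    let ?g = "\<lambda>z. R * norm (snd z - snd z0) + \<bar>support_fun (Y (fst z)) (snd z0) - support_fun (Y (fst z0)) (snd z0)\<bar>"
    have "continuous_on (T \<times> UNIV) (\<lambda>z::'t \<times> 'a. support_fun (Y (fst z)) (snd z0))"
      by (rule continuous_on_compose2[OF cont]) (auto intro!: continuous_intros)
    then have "((\<lambda>z. support_fun (Y (fst z)) (snd z0)) \<longlongrightarrow> support_fun (Y (fst z0)) (snd z0)) ?F"
      unfolding continuous_on_def using z0 by (rule bspec)
    then have "(?g \<longlongrightarrow> R * norm (snd z0 - snd z0) + \<bar>support_fun (Y (fst z0)) (snd z0) - support_fun (Y (fst z0)) (snd z0)\<bar>) ?F"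
      by (intro tendsto_intros)
    then have g: "(?g \<longlongrightarrow> 0) ?F" by simp
    have "\<forall>\<^sub>F z in ?F. z \<in> T \<times> UNIV"
      by (simp add: eventually_at_filter)
    then have "\<forall>\<^sub>F z in ?F. norm (support_fun (Y (fst z)) (snd z) - support_fun (Y (fst z0)) (snd z0)) \<le> ?g z"
    proof (rule eventually_mono)
      fix z :: "'t \<times> 'a" assume "z \<in> T \<times> UNIV"
      then have "fst z \<in> T" by auto
      then have "\<bar>support_fun (Y (fst z)) (snd z) - support_fun (Y (fst z)) (snd z0)\<bar> \<le> R * norm (snd z - snd z0)"
        by (intro support_fun_diff_le) (use R(2) Y in blast)+
      then show "norm (support_fun (Y (fst z)) (snd z) - support_fun (Y (fst z0)) (snd z0)) \<le> ?g z"
        by simp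
    qed
    then show "((\<lambda>z. support_fun (Y (fst z)) (snd z)) \<longlongrightarrow> support_fun (Y (fst z0)) (snd z0)) ?F"
      using Lim_null_comparison[OF _ g] LIM_zero_cancel by fast
  qed
qed

text \<open>Closed graph theorem for maps into a compact set: all projections stay in
  \<open>cball 0 R\<close>. In the graph, \<open>?A c\<close> over all \<open>c\<close> encodes
  membership in the moving set, and \<open>?B\<close> encodes that the candidate lies in the face
  exposed by its own residual.\<close>

lemma continuous_on_closest_point_joint:
  "continuous_on (T \<times> UNIV) (\<lambda>z. closest_point (Y (fst z)) (snd z))"
proof -
  obtain R where R: "R > 0" "\<And>t. t \<in> T \<Longrightarrow> Y t \<subseteq> cball 0 R"
    using uniformly_bounded_if_support_fun_continuous by blast
  let ?S = "T \<times> (UNIV :: 'a set)"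
  let ?p = "\<lambda>z. closest_point (Y (fst z)) (snd z)"
  have im: "?p \<in> ?S \<rightarrow> cball 0 R"
  proof
    fix z assume "z \<in> ?S"
    then have "fst z \<in> T" by auto
    then show "?p z \<in> cball 0 R"
      using R(2) Y closest_point_in_set compact_imp_closed by blast
  qed
  let ?A = "\<lambda>c. {w \<in> ?S \<times> UNIV. c \<bullet> snd w - support_fun (Y (fst (fst w))) c \<in> {..0}}"
  let ?B = "{w \<in> ?S \<times> UNIV. support_fun (Y (fst (fst w))) (snd (fst w) - snd w)
      - (snd (fst w) - snd w) \<bullet> snd w \<in> {..0}}"
  have closedS: "closed (?S \<times> (UNIV :: 'a set))"
    using T by (intro closed_Times) (auto simp: compact_imp_closed)
  have supp: "continuous_on (?S \<times> UNIV) (\<lambda>w. support_fun (Y (fst (fst w))) (h w))"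
    if "continuous_on (?S \<times> UNIV) h" for h :: "('t \<times> 'a) \<times> 'a \<Rightarrow> 'a"
    using continuous_on_compose2[OF continuous_on_support_fun_joint, of "?S \<times> UNIV" "\<lambda>w. (fst (fst w), h w)"]
      that by (force intro!: continuous_intros)
  have closed: "closed {w \<in> ?S \<times> UNIV. k w \<in> {..0}}" if "continuous_on (?S \<times> UNIV) k"
    for k :: "('t \<times> 'a) \<times> 'a \<Rightarrow> real"
    using continuous_closed_preimage[OF that closedS, of "{..0}"] by (simp add: vimage_def Int_def)
  have "closed (?A c)" for c by (intro closed continuous_intros supp)
  moreover have "closed ?B" by (intro closed continuous_intros supp)
  ultimately have "closed (?S \<times> cball 0 R \<inter> ((\<Inter>c. ?A c) \<inter> ?B))"
    using T by (intro closed_Int closed_INT closed_Times) (auto simp: compact_imp_closed)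
  moreover have "(\<lambda>z. (z, ?p z)) ` ?S = ?S \<times> cball 0 R \<inter> ((\<Inter>c. ?A c) \<inter> ?B)"
  proof -
    have "(z, q) \<in> (\<lambda>z. (z, ?p z)) ` ?S \<longleftrightarrow> (z, q) \<in> ?S \<times> cball 0 R \<inter> ((\<Inter>c. ?A c) \<inter> ?B)" for z q
    proof (cases "z \<in> ?S")
      case True
      then have "fst z \<in> T" by auto
      from eq_closest_point_iff_support_fun[of "Y (fst z)" q "snd z"] Y[OF this] True im
      show ?thesis by (auto simp: image_iff Pi_iff)
    qed auto
    then show ?thesis by (metis (no_types, lifting) subsetI subset_antisym surj_pair)
  qed
  ultimately have "closedin (top_of_set (?S \<times> cball 0 R)) ((\<lambda>z. (z, ?p z)) ` ?S)"
    by (metis (no_types, lifting) closedin_closed_Int inf.idem inf_assoc)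
  then show ?thesis
    using continuous_closed_graph_eq[OF compact_cball im] by blast
qed

end

section \<open>Estimates for the control-affine field and the regularised minimiser\<close>

lemma norm_matrix_vector_mult_le: "norm (A *v x) \<le> norm A * norm x" for A :: "real^'n^'m"
proof -
  have "norm (A *v x) = L2_set (\<lambda>i. norm ((A *v x) $ i)) UNIV" by (simp add: norm_vec_def)
  also have "\<dots> \<le> L2_set (\<lambda>i. norm (A $ i) * norm x) UNIV"
    by (rule L2_set_mono) (auto simp: matrix_vector_mul_component Cauchy_Schwarz_ineq2)
  also have "\<dots> = norm A * norm x" by (simp add: norm_vec_def L2_set_left_distrib)
  finally show ?thesis .
qed

lemma continuous_on_matrix_vector_mult [continuous_intros]:
  fixes A :: "'a::topological_space \<Rightarrow> real^'n^'m"
  assumes "continuous_on S A" "continuous_on S x"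
  shows "continuous_on S (\<lambda>s. A s *v x s)"
  unfolding matrix_vector_mult_def by (intro continuous_intros assms)

lemma continuous_on_vector_matrix_mult [continuous_intros]:
  fixes A :: "'a::topological_space \<Rightarrow> real^'n^'m"
  assumes "continuous_on S A" "continuous_on S x"
  shows "continuous_on S (\<lambda>s. x s v* A s)"
  unfolding vector_matrix_mult_def by (intro continuous_intros assms)

lemma continuously_differentiable_imp_continuous_on:
  "continuously_differentiable F \<Longrightarrow> continuous_on S F"
  unfolding continuously_differentiable_def
  by (meson continuous_at_imp_continuous_on has_derivative_continuous)

text \<open>The ball is compact, so the derivative is bounded on it, and convex, so that bound is a
  Lipschitz constant.\<close>

lemma continuously_differentiable_imp_lipschitz_on_cball:
  fixes F :: "'a::euclidean_space \<Rightarrow> 'b::real_normed_vector"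
  assumes "continuously_differentiable F"
  obtains L where "L-lipschitz_on (cball z R) F"
proof -
  obtain F' where F': "\<And>x. (F has_derivative blinfun_apply (F' x)) (at x)" "continuous_on UNIV F'"
    using assms by (auto simp: continuously_differentiable_def)
  have "bounded (F' ` cball z R)"
    by (intro compact_imp_bounded compact_continuous_image continuous_on_subset[OF F'(2)]) auto
  then obtain L where L: "L > 0" "\<And>x. x \<in> cball z R \<Longrightarrow> norm (F' x) \<le> L"
    by (auto simp: bounded_pos)
  show ?thesis
  proof (rule that, rule bounded_derivative_imp_lipschitz)
    show "(F has_derivative blinfun_apply (F' x)) (at x within cball z R)" for x
      by (rule has_derivative_at_withinI[OF F'(1)])
  qed (use L in \<open>auto simp: norm_blinfun.rep_eq\<close>)
qed

text \<open>\<open>u\<close> minimises the linear functional plus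
  \<open>\<delta>\<^sup>2 / 2\<close> times the squared norm, by completing the square. The
  variational inequality of the projection bounds its excess over \<nu> by
  \<open>\<delta>\<^sup>2 * (u \<bullet> (\<nu> - u))\<close>, and both points have norm at most
  \<open>M\<close>.\<close>

lemma closest_point_nearly_minimizes:
  fixes A :: "real^'u^'x" and n :: "real^'x"
  assumes U: "compact U" "convex U" and M: "U \<subseteq> cball 0 M" and "\<nu> \<in> U" "\<delta> \<noteq> 0"
  defines "u \<equiv> closest_point U (- (1 / \<delta>\<^sup>2) *\<^sub>R (n v* A))"
  shows "n \<bullet> (A *v u) \<le> n \<bullet> (A *v \<nu>) + 2 * M\<^sup>2 * \<delta>\<^sup>2"
proof -
  have u: "u \<in> U"
    unfolding u_def using U assms(4) by (intro closest_point_in_set) (auto simp: compact_imp_closed)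
  have norms: "norm u \<le> M" "norm \<nu> \<le> M" using u M \<open>\<nu> \<in> U\<close> by auto
  have "u \<bullet> (\<nu> - u) \<le> norm u * norm (\<nu> - u)" by (rule norm_cauchy_schwarz)
  also have "\<dots> \<le> M * (2 * M)"
    using norms norm_triangle_ineq4[of \<nu> u] order_trans[OF norm_ge_zero norms(1)]
    by (intro mult_mono) auto
  finally have "u \<bullet> (\<nu> - u) \<le> 2 * M\<^sup>2" by (simp add: power2_eq_square)
  moreover have "(- (1 / \<delta>\<^sup>2) *\<^sub>R (n v* A) - u) \<bullet> (\<nu> - u) \<le> 0"
    unfolding u_def using U \<open>\<nu> \<in> U\<close> by (intro closest_point_dot) (auto simp: compact_imp_closed)
  then have "- ((n v* A) \<bullet> (\<nu> - u)) / \<delta>\<^sup>2 \<le> u \<bullet> (\<nu> - u)"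
    by (simp add: inner_diff_left)
  ultimately have "- ((n v* A) \<bullet> (\<nu> - u)) / \<delta>\<^sup>2 \<le> 2 * M\<^sup>2" by linarith
  then have "- ((n v* A) \<bullet> (\<nu> - u)) \<le> 2 * M\<^sup>2 * \<delta>\<^sup>2"
    using \<open>\<delta> \<noteq> 0\<close> by (subst (asm) pos_divide_le_eq) auto
  then show ?thesis by (simp add: inner_diff_right dot_lmul_matrix)
qed

text \<open>For each \<nu> the pair of \<open>p\<close> and \<omega> contributes one element to the
  Gamma set. Replacing the control term by its lower bound \<open>a\<close> makes the estimate
  independent of \<nu>, so it survives the infimum without any exchange of minimum and
  maximum.\<close>

lemma min_max_ge_at_support_point:
  fixes f :: "real^'nx \<Rightarrow> real^'nw \<Rightarrow> real^'nx" and G :: "real^'nx \<Rightarrow> real^'nu^'nx"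
  assumes f: "continuous_on UNIV (\<lambda>(x, w). f x w)" and G: "continuous_on UNIV G"
    and "compact Z" "compact W" "U \<noteq> {}"
    and p: "p \<in> Z" "c \<bullet> p = support_fun Z c" and "\<omega> \<in> W"
    and a: "\<And>\<nu>. \<nu> \<in> U \<Longrightarrow> a \<le> c \<bullet> (G p *v \<nu>)"
  shows "c \<bullet> f p \<omega> + a \<le> (INF \<nu>\<in>U. support_fun (Gamma_set (control_affine f G) W \<nu> c Z) c)"
proof (rule cINF_greatest[OF \<open>U \<noteq> {}\<close>])
  fix \<nu> assume "\<nu> \<in> U"
  let ?\<Gamma> = "Gamma_set (control_affine f G) W \<nu> c Z"
  \<comment> \<open>Boundedness of the Gamma set is what makes its \<open>SUP\<close> a genuine
    upper bound.\<close>
  have "compact ((\<lambda>z. (\<lambda>(x, w). f x w) z + G (fst z) *v \<nu>) ` (Z \<times> W))"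
    by (intro compact_continuous_image compact_Times continuous_intros assms
        continuous_on_subset[OF f] continuous_on_compose2[OF G]) auto
  moreover have "?\<Gamma> \<subseteq> (\<lambda>z. (\<lambda>(x, w). f x w) z + G (fst z) *v \<nu>) ` (Z \<times> W)"
    by (force simp: Gamma_set_def control_affine_def)
  ultimately have "bounded ?\<Gamma>" using bounded_subset compact_imp_bounded by blast
  moreover have "f p \<omega> + G p *v \<nu> \<in> ?\<Gamma>"
    using p \<open>\<omega> \<in> W\<close> by (auto simp: Gamma_set_def control_affine_def)
  ultimately have "c \<bullet> (f p \<omega> + G p *v \<nu>) \<le> support_fun ?\<Gamma> c" by (rule support_fun_upper)
  then show "c \<bullet> f p \<omega> + a \<le> support_fun ?\<Gamma> c"
    using a[OF \<open>\<nu> \<in> U\<close>] by (simp add: inner_add_right)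
qed

section \<open>Caratheodory solutions and the feedback law\<close>

lemma solution_on_diff:
  assumes "solution_on F a b x" "r \<in> {a..b}" "s \<in> {a..b}" "r \<le> s"
  shows "(\<lambda>t. F t (x t)) integrable_on {r..s}" "x s - x r = integral {r..s} (\<lambda>t. F t (x t))"
proof -
  have int: "(\<lambda>t. F t (x t)) integrable_on {a..b}"
    using assms(1) by (auto simp: solution_on_def intro: set_lebesgue_integral_eq_integral(1))
  then show "(\<lambda>t. F t (x t)) integrable_on {r..s}"
    by (rule integrable_subinterval_real) (use assms in auto)
  have "(\<lambda>t. F t (x t)) integrable_on {a..s}"
    by (rule integrable_subinterval_real[OF int]) (use assms in auto)
  then have "integral {a..r} (\<lambda>t. F t (x t)) + integral {r..s} (\<lambda>t. F t (x t)) = integral {a..s} (\<lambda>t. F t (x t))"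
    by (intro Henstock_Kurzweil_Integration.integral_combine) (use assms in auto)
  moreover have "x s = x a + integral {a..s} (\<lambda>t. F t (x t))" "x r = x a + integral {a..r} (\<lambda>t. F t (x t))"
    using assms unfolding solution_on_def by blast+
  ultimately show "x s - x r = integral {r..s} (\<lambda>t. F t (x t))"
    by (metis add_diff_cancel_left add_diff_cancel_left')
qed

lemma solution_on_continuous:
  assumes "solution_on F a b x"
  shows "continuous_on {a..b} x"
proof -
  have "continuous_on {a..b} (\<lambda>t. x a + integral {a..t} (\<lambda>t. F t (x t)))"
    using assms by (auto simp: solution_on_def intro!: continuous_intros indefinite_integral_continuous_1
        intro: set_lebesgue_integral_eq_integral(1))
  then show ?thesis
  proof (rule continuous_on_eq)
    show "x a + integral {a..t} (\<lambda>t. F t (x t)) = x t" if "t \<in> {a..b}" for t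
      using assms that unfolding solution_on_def by metis
  qed
qed

text \<open>Integrating a bound valid close to \<open>s\<close> replaces differentiating at
  \<open>s\<close>. The estimate therefore holds at every \<open>s\<close>, including times where
  the solution has no derivative.\<close>

lemma solution_on_left_growth:
  assumes sol: "solution_on F a b x" and s: "s \<in> {a<..b}"
    and k: "continuous (at s within {a..b}) k"
    and le: "\<And>t. t \<in> {a..b} \<Longrightarrow> n \<bullet> F t (x t) \<le> k t" and "k s < E"
  shows "\<forall>\<^sub>F r in at_left s. n \<bullet> (x s - x r) \<le> E * (s - r)"
proof -
  have "(k \<longlongrightarrow> k s) (at_left s)"
    using k at_left_le_at_within[OF s] by (auto simp: continuous_within intro: tendsto_mono)
  then have "\<forall>\<^sub>F t in at_left s. k t < E" using \<open>k s < E\<close> by (rule order_tendstoD)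
  then obtain d where d: "d < s" "\<And>t. d < t \<Longrightarrow> t < s \<Longrightarrow> k t < E"
    by (auto simp: eventually_at_left[of a s] eventually_at_left_field)
  have "\<forall>\<^sub>F r in at_left s. r \<in> {max a d<..<s}"
    by (rule eventually_at_leftI[of "max a d"]) (use s d in auto)
  then show ?thesis
  proof (rule eventually_mono)
    fix r assume r: "r \<in> {max a d<..<s}"
    have rs: "r \<in> {a..b}" "s \<in> {a..b}" "r \<le> s" using r s by auto
    note int = solution_on_diff[OF sol rs]
    have "n \<bullet> (x s - x r) = integral {r..s} (\<lambda>t. n \<bullet> F t (x t))"
      using integral_linear[OF int(1) bounded_linear_inner_right[of n]] int(2) by (simp add: o_def)
    also have "\<dots> \<le> integral {r..s} (\<lambda>t. E)"
    proof (rule integral_le)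
      show "(\<lambda>t. n \<bullet> F t (x t)) integrable_on {r..s}"
        using integrable_linear[OF int(1) bounded_linear_inner_right[of n]] by (simp add: o_def)
      show "n \<bullet> F t (x t) \<le> E" if "t \<in> {r..s}" for t
        using le[of t] d(2)[of t] \<open>k s < E\<close> r rs that by (cases "t = s") force+
    qed auto
    also have "\<dots> = E * (s - r)" using r by simp
    finally show "n \<bullet> (x s - x r) \<le> E * (s - r)" .
  qed
qed

text \<open>For \<open>x \<notin> Y t\<close> with outward normal \<open>n = x - p\<close> this is the minimiser over \<open>\<nu> \<in> U\<close> of
  \<open>n \<bullet> (G x *v \<nu>) + (norm n)\<^sup>2 * (norm \<nu>)\<^sup>2 / 2\<close>. The quadratic term makes it unique, hence continuous in
  \<open>(t, x)\<close> off the tube, at a cost of order \<open>(norm n)\<^sup>2\<close> only. For \<open>x \<in> Y t\<close> the value is the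
  irrelevant \<open>closest_point U 0\<close>, since \<open>1 / 0 = 0\<close>.\<close>

definition tube_feedback ::
  "(real^'nx \<Rightarrow> real^'nu^'nx) \<Rightarrow> (real^'nu) set \<Rightarrow> (real \<Rightarrow> (real^'nx) set) \<Rightarrow> real \<Rightarrow> real^'nx \<Rightarrow> real^'nu" where
  "tube_feedback G U Y t x =
     (let n = x - closest_point (Y t) x in closest_point U (- (1 / (norm n)\<^sup>2) *\<^sub>R (n v* G x)))"

section \<open>The closed loop: integrability, growth of the distance, invariance\<close>

locale tube_system =
  fixes f :: "real^'nx \<Rightarrow> real^'nw \<Rightarrow> real^'nx"
    and G :: "real^'nx \<Rightarrow> real^'nu^'nx"
    and U :: "(real^'nu) set"
    and W :: "(real^'nw) set"
    and Y :: "real \<Rightarrow> (real^'nx) set"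
    and t1 t2 :: real
  assumes U: "compact U" "convex U" "U \<noteq> {}"
    and W: "compact W"
    and f_cont: "continuous_on UNIV (\<lambda>(x, w). f x w)"
    and f_lip: "local_lipschitz UNIV UNIV (\<lambda>w x. f x w)"
    and G_C1: "continuously_differentiable G"
    and Y: "\<And>t. t \<in> {t1..t2} \<Longrightarrow> compact (Y t) \<and> convex (Y t) \<and> Y t \<noteq> {}"
    and Y_lip: "\<And>c. \<exists>L. L-lipschitz_on {t1..t2} (\<lambda>t. support_fun (Y t) c)"
    and ineq: "min_max_differential_inequality (control_affine f G) U W t1 t2 Y"
begin

lemma G_cont: "continuous_on S G"
  using continuously_differentiable_imp_continuous_on[OF G_C1] .

lemma f_cont_snd: "continuous_on S (f y)"
proof -
  have "continuous_on S (\<lambda>\<omega>. (\<lambda>(x, w). f x w) (y, \<omega>))"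
    by (intro continuous_on_compose2[OF f_cont] continuous_on_Pair continuous_on_const continuous_on_id) auto
  then show ?thesis by simp
qed

lemma Y_cont: "continuous_on {t1..t2} (\<lambda>t. support_fun (Y t) c)"
  using Y_lip[of c] lipschitz_on_continuous_on by blast

lemma closest_point_cont:
  "continuous_on ({t1..t2} \<times> UNIV) (\<lambda>z. closest_point (Y (fst z)) (snd z))"
  by (rule continuous_on_closest_point_joint[OF compact_Icc Y Y_cont])

lemma tube_feedback_in: "tube_feedback G U Y t x \<in> U"
  using U by (simp add: tube_feedback_def Let_def closest_point_in_set compact_imp_closed)

text \<open>On a compact set the feedback is the continuous \<open>closest_point U\<close> applied
  to a quotient of continuous functions. Such a quotient is measurable across the zeros of its
  denominator as well, and the values lie in the bounded set \<open>U\<close>.\<close>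

lemma feedback_law: "feedback_law U t1 t2 (tube_feedback G U Y)"
  unfolding feedback_law_def locally_integrable_on_def
proof (intro conjI ballI allI impI tube_feedback_in)
  fix K :: "(real \<times> (real^'nx)) set"
  assume K: "compact K \<and> K \<subseteq> {t1..t2} \<times> UNIV"
  then have K_sets: "K \<in> sets lebesgue"
    by (simp add: compact_imp_closed borel_closed)
  obtain M where M: "\<And>u. u \<in> U \<Longrightarrow> norm u \<le> M"
    using compact_imp_bounded[OF U(1)] by (auto simp: bounded_iff)
  define n where "n z = snd z - closest_point (Y (fst z)) (snd z)" for z :: "real \<times> (real^'nx)"
  have n: "continuous_on K n"
    unfolding n_def by (intro continuous_intros continuous_on_subset[OF closest_point_cont]) (use K in auto)
  then have "continuous_on K (\<lambda>z. n z v* G (snd z))"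
    by (intro continuous_intros continuous_on_compose2[OF G_cont[of UNIV]]) auto
  moreover have "continuous_on K (\<lambda>z. (norm (n z))\<^sup>2)" using n by (intro continuous_intros)
  ultimately have "(\<lambda>z. n z v* G (snd z)) \<in> borel_measurable (lebesgue_on K)"
    "(\<lambda>z. (norm (n z))\<^sup>2) \<in> borel_measurable (lebesgue_on K)"
    using K_sets continuous_imp_measurable_on_sets_lebesgue by blast+
  then have "(\<lambda>z. - (1 / (norm (n z))\<^sup>2) *\<^sub>R (n z v* G (snd z))) \<in> borel_measurable (lebesgue_on K)"
    by (intro borel_measurable_scaleR borel_measurable_uminus borel_measurable_divide borel_measurable_const)
  moreover have "continuous_on UNIV (closest_point U)"
    using U by (intro continuous_on_closest_point) (auto simp: compact_imp_closed)
  ultimately have "(\<lambda>z. closest_point U (- (1 / (norm (n z))\<^sup>2) *\<^sub>R (n z v* G (snd z)))) \<in> borel_measurable (lebesgue_on K)"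
    using measurable_compose[OF _ borel_measurable_continuous_onI] by blast
  moreover have "(\<lambda>(t, x). tube_feedback G U Y t x) = (\<lambda>z. closest_point U (- (1 / (norm (n z))\<^sup>2) *\<^sub>R (n z v* G (snd z))))"
    by (auto simp: tube_feedback_def n_def Let_def)
  ultimately have "(\<lambda>(t, x). tube_feedback G U Y t x) \<in> borel_measurable (lebesgue_on K)" by simp
  then show "(\<lambda>(t, x). tube_feedback G U Y t x) absolutely_integrable_on K"
  proof (rule measurable_bounded_by_integrable_imp_absolutely_integrable[OF _ K_sets])
    show "(\<lambda>_. M) integrable_on K"
      using K by (intro integrable_on_const lmeasurable_compact) auto
    show "norm ((\<lambda>(t, x). tube_feedback G U Y t x) z) \<le> M" for z
      using M tube_feedback_in by (auto split: prod.split)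
  qed
qed

text \<open>\<open>D\<close> is any bound on the speed along \<open>n s\<close> at the projection,
  taken over all disturbances and with the control term replaced by its lower bounds over
  \<open>U\<close>. Leaving \<open>D\<close> open lets one estimate serve twice: with a crude bound
  at exceptional times, and with the derivative of the support function elsewhere. \<open>C\<close>
  may depend on the solution but not on \<open>s\<close>.\<close>

lemma distance_growth:
  assumes sol: "solution_on (\<lambda>t y. control_affine f G y (tube_feedback G U Y t y) (w t)) t1 t2 x"
    and w: "\<And>t. w t \<in> W"
  defines "p \<equiv> \<lambda>s. closest_point (Y s) (x s)"
  defines "n \<equiv> \<lambda>s. x s - p s"
  obtains C where "C \<ge> 0"
    "\<And>s D e. s \<in> {t1<..t2} \<Longrightarrow> n s \<noteq> 0 \<Longrightarrow> e > 0 \<Longrightarrow>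
      (\<And>\<omega> a. \<omega> \<in> W \<Longrightarrow> (\<And>\<nu>. \<nu> \<in> U \<Longrightarrow> a \<le> n s \<bullet> (G (p s) *v \<nu>)) \<Longrightarrow> n s \<bullet> f (p s) \<omega> + a \<le> D) \<Longrightarrow>
      \<forall>\<^sub>F r in at_left s. norm (n s) * (norm (n s) - norm (n r))
         \<le> (D + C * (norm (n s))\<^sup>2 + e) * (s - r) - (support_fun (Y s) (n s) - support_fun (Y r) (n s))"
proof -
  let ?T = "{t1..t2}"
  have x: "continuous_on ?T x" by (rule solution_on_continuous[OF sol])
  have p: "continuous_on ?T p"
    unfolding p_def
    using continuous_on_compose2[OF closest_point_cont, of ?T "\<lambda>s. (s, x s)"] x
    by (force intro!: continuous_intros)
  have n: "continuous_on ?T n" unfolding n_def by (intro continuous_intros x p)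
  have "bounded (x ` ?T \<union> p ` ?T)"
    by (simp add: compact_imp_bounded compact_continuous_image x p)
  then obtain R where R: "x ` ?T \<union> p ` ?T \<subseteq> cball 0 R"
    by (metis bounded_subset_ballD ball_subset_cball order_trans)
  obtain M where M: "M > 0" "U \<subseteq> cball 0 M"
    using compact_imp_bounded[OF U(1)] by (auto simp: bounded_pos subset_eq)
  obtain LG where LG: "LG-lipschitz_on (cball 0 R) G"
    using continuously_differentiable_imp_lipschitz_on_cball[OF G_C1] by blast
  have "local_lipschitz W (cball 0 R) (\<lambda>w x. f x w)"
    by (rule local_lipschitz_subset[OF f_lip]) auto
  then obtain Lf where Lf: "\<And>\<omega>. \<omega> \<in> W \<Longrightarrow> Lf-lipschitz_on (cball 0 R) (\<lambda>y. f y \<omega>)"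
    using local_lipschitz_compact_implies_lipschitz[of W "cball 0 R" "\<lambda>w x. f x w"] W f_cont_snd by auto
  have Lf0: "Lf \<ge> 0" using Lf[OF w] lipschitz_on_nonneg by blast
  have LG0: "LG \<ge> 0" using LG lipschitz_on_nonneg by blast
  \<comment> \<open>The three terms pay for evaluating \<open>f\<close> at \<open>x\<close> instead
    of \<open>p\<close>, for doing the same with \<open>G\<close>, and for the regularisation in the
    feedback.\<close>
  define C where "C = Lf + LG * M + 2 * M\<^sup>2"
  show ?thesis
  proof
    show "C \<ge> 0" using Lf0 LG0 M by (simp add: C_def)
    fix s D e :: real
    assume s: "s \<in> {t1<..t2}" and ns: "n s \<noteq> 0" and e: "e > 0"
      and D: "\<And>\<omega> a. \<omega> \<in> W \<Longrightarrow> (\<And>\<nu>. \<nu> \<in> U \<Longrightarrow> a \<le> n s \<bullet> (G (p s) *v \<nu>)) \<Longrightarrow> n s \<bullet> f (p s) \<omega> + a \<le> D"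
    define u where "u t = tube_feedback G U Y t (x t)" for t
    have u_eq: "u t = closest_point U (- (1 / (norm (n t))\<^sup>2) *\<^sub>R (n t v* G (x t)))" for t
      by (simp add: u_def tube_feedback_def n_def p_def Let_def)
    have sT: "s \<in> ?T" using s by auto
    have ball: "x t \<in> cball 0 R" "p t \<in> cball 0 R" if "t \<in> ?T" for t using R that by blast+
    \<comment> \<open>\<open>a\<close> bounds \<open>n s \<bullet> (G (p s) *v \<nu>)\<close> from below over \<open>U\<close>, and is attained by \<open>u s\<close> up to
      \<open>O((norm (n s))\<^sup>2)\<close>; \<open>k\<close> dominates the velocity along \<open>n s\<close> uniformly in the disturbance and is
      continuous at \<open>s\<close>, so no differentiability of \<open>x\<close> at \<open>s\<close> is needed.\<close>
    define a where "a = n s \<bullet> (G (x s) *v u s) - (LG * M + 2 * M\<^sup>2) * (norm (n s))\<^sup>2"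
    have a: "a \<le> n s \<bullet> (G (p s) *v \<nu>)" if "\<nu> \<in> U" for \<nu>
    proof -
      have "n s \<bullet> (G (x s) *v u s) \<le> n s \<bullet> (G (x s) *v \<nu>) + 2 * M\<^sup>2 * (norm (n s))\<^sup>2"
        unfolding u_eq by (rule closest_point_nearly_minimizes[OF U(1,2) M(2) that]) (use ns in simp)
      also have "n s \<bullet> (G (x s) *v \<nu>) = n s \<bullet> (G (p s) *v \<nu>) + n s \<bullet> ((G (x s) - G (p s)) *v \<nu>)"
        by (simp add: matrix_vector_mult_diff_rdistrib inner_diff_right)
      also have "n s \<bullet> ((G (x s) - G (p s)) *v \<nu>) \<le> norm (n s) * ((LG * norm (n s)) * M)"
      proof -
        have "norm (G (x s) - G (p s)) \<le> LG * norm (n s)"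
          using lipschitz_onD[OF LG ball(1)[OF sT] ball(2)[OF sT]] by (simp add: dist_norm n_def)
        moreover have "norm \<nu> \<le> M" using that M by auto
        ultimately have "norm ((G (x s) - G (p s)) *v \<nu>) \<le> (LG * norm (n s)) * M"
          using LG0 by (intro order_trans[OF norm_matrix_vector_mult_le] mult_mono) auto
        then show ?thesis
          using norm_cauchy_schwarz[of "n s" "(G (x s) - G (p s)) *v \<nu>"]
          by (meson mult_left_mono norm_ge_zero order_trans)
      qed
      finally show ?thesis by (simp add: a_def power2_eq_square algebra_simps)
    qed
    define k where "k t = (D - a) + norm (n s) * (Lf * (norm (x t - x s) + norm (n s))) + n s \<bullet> (G (x t) *v u t)" for t
    have k_s: "k s = D + C * (norm (n s))\<^sup>2"
      by (simp add: k_def a_def C_def power2_eq_square algebra_simps)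
    have "continuous (at s within ?T) k"
    proof -
      let ?F = "at s within ?T"
      have lims: "(x \<longlongrightarrow> x s) ?F" "(n \<longlongrightarrow> n s) ?F" using x n sT by (auto simp: continuous_on_def)
      have G_lim: "((\<lambda>t. G (x t)) \<longlongrightarrow> G (x s)) ?F"
        using continuous_on_compose2[OF G_cont[of UNIV] x] sT by (auto simp: continuous_on_def)
      \<comment> \<open>Since \<open>n s\<close> is nonzero, the division in the feedback is
        continuous at \<open>s\<close>; this is where being off the tube is used.\<close>
      have "((\<lambda>t. - (1 / (norm (n t))\<^sup>2) *\<^sub>R (n t v* G (x t))) \<longlongrightarrow> - (1 / (norm (n s))\<^sup>2) *\<^sub>R (n s v* G (x s))) ?F"
        unfolding vector_matrix_mult_def by (intro tendsto_intros lims G_lim) (use ns in simp)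
      then have "(u \<longlongrightarrow> u s) ?F"
        unfolding u_eq using U by (intro isCont_tendsto_compose[OF continuous_at_closest_point]) (auto simp: compact_imp_closed)
      then show ?thesis
        unfolding continuous_within k_def matrix_vector_mult_def by (intro tendsto_intros lims G_lim)
    qed
    moreover have "n s \<bullet> control_affine f G (x t) (tube_feedback G U Y t (x t)) (w t) \<le> k t" if t: "t \<in> ?T" for t
    proof -
      have "norm (f (x t) (w t) - f (p s) (w t)) \<le> Lf * norm (x t - p s)"
        using lipschitz_onD[OF Lf[OF w] ball(1)[OF t] ball(2)[OF sT]] by (simp add: dist_norm)
      also have "\<dots> \<le> Lf * (norm (x t - x s) + norm (n s))"
        using Lf0 norm_triangle_ineq[of "x t - x s" "n s"] by (intro mult_left_mono) (auto simp: n_def)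
      finally have "n s \<bullet> (f (x t) (w t) - f (p s) (w t)) \<le> norm (n s) * (Lf * (norm (x t - x s) + norm (n s)))"
        by (meson norm_cauchy_schwarz mult_left_mono norm_ge_zero order_trans)
      moreover have "n s \<bullet> f (p s) (w t) \<le> D - a" using D[OF w a] by (simp add: algebra_simps)
      ultimately show ?thesis
        by (simp add: control_affine_def k_def u_def inner_add_right inner_diff_right)
    qed
    ultimately have "\<forall>\<^sub>F r in at_left s. n s \<bullet> (x s - x r) \<le> (D + C * (norm (n s))\<^sup>2 + e) * (s - r)"
      by (rule solution_on_left_growth[OF sol s]) (use e k_s in simp_all)
    moreover have "\<forall>\<^sub>F r in at_left s. r \<in> {t1<..<s}"
      by (rule eventually_at_leftI[of t1]) (use s in auto)
    ultimately show "\<forall>\<^sub>F r in at_left s. norm (n s) * (norm (n s) - norm (n r))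
         \<le> (D + C * (norm (n s))\<^sup>2 + e) * (s - r) - (support_fun (Y s) (n s) - support_fun (Y r) (n s))"
    proof eventually_elim
      case (elim r)
      have r: "r \<in> ?T" using elim s by auto
      have "p r \<in> Y r" unfolding p_def using Y[OF r] by (simp add: closest_point_in_set compact_imp_closed)
      \<comment> \<open>The normal stays fixed at \<open>n s\<close> while \<open>r\<close> moves:
        \<open>norm (n s) * norm (n r) \<ge> n s \<bullet> n r = n s \<bullet> x r - n s \<bullet> p
        r\<close>, and the last term is at most the support function of \<open>Y r\<close> in
        direction \<open>n s\<close>. At \<open>r = s\<close> both inequalities are
        equalities.\<close>
      then have "n s \<bullet> p r \<le> support_fun (Y r) (n s)"
        using Y[OF r] by (simp add: support_fun_upper compact_imp_bounded)
      moreover have "n s \<bullet> n r \<le> norm (n s) * norm (n r)" by (rule norm_cauchy_schwarz)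
      moreover have "support_fun (Y s) (n s) = n s \<bullet> p s"
        using support_fun_closest_point[of "Y s" "x s"] Y[OF sT] by (simp add: n_def p_def)
      moreover have "norm (n s) * norm (n s) = n s \<bullet> n s"
        by (metis power2_norm_eq_inner power2_eq_square)
      moreover have "n s \<bullet> (x s - x r) = n s \<bullet> n s + n s \<bullet> p s - (n s \<bullet> n r + n s \<bullet> p r)"
      proof -
        have "x s - x r = (n s + p s) - (n r + p r)" by (simp add: n_def)
        then show ?thesis by (simp only: inner_add_right inner_diff_right)
      qed
      ultimately show ?case using elim(1) by (simp add: right_diff_distrib)
    qed
  qed
qed

text \<open>The distance to the tube starts at 0 and meets the hypotheses of
  \<open>nonpos_if_left_Dini_le\<close>: Lipschitz continuity in the single direction
  \<open>n s\<close> gives a finite rate at every time off the tube, and the differential inequality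
  gives the rate \<open>C + 1\<close> outside a null set.\<close>

lemma invariant:
  assumes sol: "solution_on (\<lambda>t y. control_affine f G y (tube_feedback G U Y t y) (w t)) t1 t2 x"
    and w: "\<And>t. w t \<in> W"
    and ab: "a \<in> {t1..t2}" "b \<in> {t1..t2}" "a \<le> b" and "x a \<in> Y a"
  shows "x b \<in> Y b"
proof -
  let ?T = "{t1..t2}"
  define p where "p s = closest_point (Y s) (x s)" for s
  define n where "n s = x s - p s" for s
  obtain C where C: "C \<ge> 0"
    and growth: "\<And>s D e. s \<in> {t1<..t2} \<Longrightarrow> n s \<noteq> 0 \<Longrightarrow> e > 0 \<Longrightarrow>
      (\<And>\<omega> a. \<omega> \<in> W \<Longrightarrow> (\<And>\<nu>. \<nu> \<in> U \<Longrightarrow> a \<le> n s \<bullet> (G (p s) *v \<nu>)) \<Longrightarrow> n s \<bullet> f (p s) \<omega> + a \<le> D) \<Longrightarrow>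
      \<forall>\<^sub>F r in at_left s. norm (n s) * (norm (n s) - norm (n r))
         \<le> (D + C * (norm (n s))\<^sup>2 + e) * (s - r) - (support_fun (Y s) (n s) - support_fun (Y r) (n s))"
    using distance_growth[OF sol w] unfolding n_def p_def by blast
  \<comment> \<open>The quantifier over \<open>c\<close> stays inside \<open>Q\<close> because the
    direction to be inserted, \<open>n s\<close>, varies with the time \<open>s\<close>; the null
    set must be common to all directions.\<close>
  define Q where "Q t \<longleftrightarrow> (\<forall>c. \<exists>D.
        ((\<lambda>s. support_fun (Y s) c) has_real_derivative D) (at t within ?T) \<and>
        D \<ge> (INF \<nu>\<in>U. support_fun (Gamma_set (control_affine f G) W \<nu> c (Y t)) c))" for t
  have "AE t in lebesgue. t \<in> ?T \<longrightarrow> Q t"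
    using ineq by (simp add: min_max_differential_inequality_def Q_def)
  then obtain N where N: "negligible N" and deriv: "\<And>t. t \<in> ?T \<Longrightarrow> t \<notin> N \<Longrightarrow> Q t"
    unfolding eventually_ae_filter negligible_iff_null_sets by auto
  have x: "continuous_on ?T x" by (rule solution_on_continuous[OF sol])
  have "continuous_on ?T p"
    unfolding p_def
    using continuous_on_compose2[OF closest_point_cont, of ?T "\<lambda>s. (s, x s)"] x
    by (force intro!: continuous_intros)
  then have n: "continuous_on ?T n" unfolding n_def by (intro continuous_intros x)
  have p_in: "p s \<in> Y s" if "s \<in> ?T" for s
    unfolding p_def using Y[OF that] by (simp add: closest_point_in_set compact_imp_closed)
  have ev: "\<forall>\<^sub>F r in at_left s. r \<in> {t1<..<s}" if "s \<in> {a<..b}" for s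
    by (rule eventually_at_leftI[of t1]) (use that ab in auto)
  have "norm (n b) \<le> 0"
  proof (rule nonpos_if_left_Dini_le[where \<psi> = "\<lambda>s. norm (n s)" and N = N and L = "C + 1" and a = a])
    show "continuous_on {a..b} (\<lambda>s. norm (n s))"
      by (intro continuous_intros continuous_on_subset[OF n]) (use ab in auto)
    show "norm (n a) \<le> 0" using \<open>x a \<in> Y a\<close> by (simp add: n_def p_def closest_point_self)
  next
    fix s assume s: "s \<in> {a<..b}" and "norm (n s) > 0"
    have sT: "s \<in> {t1<..t2}" using s ab by auto
    have ns: "n s \<noteq> 0" using \<open>norm (n s) > 0\<close> by simp
    obtain L where L: "L-lipschitz_on ?T (\<lambda>t. support_fun (Y t) (n s))" using Y_lip by blast
    obtain \<nu>0 where "\<nu>0 \<in> U" using U by blast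
    have "bounded (f (p s) ` W)"
      using W f_cont_snd compact_continuous_image compact_imp_bounded by blast
    then obtain B where B: "\<And>\<omega>. \<omega> \<in> W \<Longrightarrow> norm (f (p s) \<omega>) \<le> B" by (auto simp: bounded_iff)
    \<comment> \<open>A crude bound: an arbitrary fixed control \<open>\<nu>0\<close> already limits
      every admissible lower bound \<open>a\<close>.\<close>
    define D where "D = norm (n s) * B + n s \<bullet> (G (p s) *v \<nu>0)"
    have D: "n s \<bullet> f (p s) \<omega> + a \<le> D"
      if "\<omega> \<in> W" "\<And>\<nu>. \<nu> \<in> U \<Longrightarrow> a \<le> n s \<bullet> (G (p s) *v \<nu>)" for \<omega> a
      using B[OF that(1)] that(2)[OF \<open>\<nu>0 \<in> U\<close>] norm_cauchy_schwarz[of "n s" "f (p s) \<omega>"]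
        mult_left_mono[OF B[OF that(1)] norm_ge_zero[of "n s"]]
      by (simp add: D_def)
    \<comment> \<open>The slack \<open>e\<close> is taken as 1, and \<open>L\<close> bounds the
      increments of the support function. As \<open>L\<close> belongs to the direction
      \<open>n s\<close>, this rate need not be uniform in \<open>s\<close>.\<close>
    define K where "K = (D + C * (norm (n s))\<^sup>2 + 1 + L) / norm (n s)"
    have "\<forall>\<^sub>F r in at_left s. norm (n s) - norm (n r) \<le> K * (s - r)"
      using growth[OF sT ns zero_less_one D, simplified] ev[OF s]
    proof eventually_elim
      case (elim r)
      have "\<bar>support_fun (Y s) (n s) - support_fun (Y r) (n s)\<bar> \<le> L * (s - r)"
        using lipschitz_onD[OF L, of s r] elim sT by (auto simp: dist_real_def)
      then have "norm (n s) * (norm (n s) - norm (n r)) \<le> (D + C * (norm (n s))\<^sup>2 + 1 + L) * (s - r)"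
        using elim(1) by (simp add: algebra_simps)
      then show ?case
        using \<open>norm (n s) > 0\<close> by (simp add: K_def pos_le_divide_eq mult.commute)
    qed
    then show "\<exists>K. \<forall>\<^sub>F r in at_left s. norm (n s) - norm (n r) \<le> K * (s - r)" by blast
  next
    fix s assume s: "s \<in> {a<..b}" and "s \<notin> N" and pos: "norm (n s) > 0"
    have sT: "s \<in> {t1<..t2}" "s \<in> ?T" using s ab by auto
    have ns: "n s \<noteq> 0" using pos by simp
    obtain D where D: "((\<lambda>r. support_fun (Y r) (n s)) has_real_derivative D) (at s within ?T)"
      "D \<ge> (INF \<nu>\<in>U. support_fun (Gamma_set (control_affine f G) W \<nu> (n s) (Y s)) (n s))"
      using deriv[OF sT(2) \<open>s \<notin> N\<close>] unfolding Q_def by blast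
    \<comment> \<open>The slack is spent twice, once in \<open>growth\<close> and once on the
      difference quotient of the support function. Together they cost
      \<open>(norm (n s))\<^sup>2\<close>, which turns \<open>C\<close> into
      \<open>C + 1\<close>.\<close>
    define e where "e = (norm (n s))\<^sup>2 / 2"
    have e: "e > 0" using pos by (simp add: e_def)
    have face: "n s \<bullet> p s = support_fun (Y s) (n s)"
      using support_fun_closest_point[of "Y s" "x s"] Y[OF sT(2)] by (simp add: n_def p_def)
    have D_ge: "n s \<bullet> f (p s) \<omega> + a \<le> D"
      if "\<omega> \<in> W" "\<And>\<nu>. \<nu> \<in> U \<Longrightarrow> a \<le> n s \<bullet> (G (p s) *v \<nu>)" for \<omega> a
      using min_max_ge_at_support_point[OF f_cont G_cont _ W U(3) p_in[OF sT(2)] face that] Y[OF sT(2)] D(2)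
      by fastforce
    have "((\<lambda>r. (support_fun (Y r) (n s) - support_fun (Y s) (n s)) / (r - s)) \<longlongrightarrow> D) (at_left s)"
      using D(1) at_left_le_at_within[OF sT(1)] by (auto simp: has_field_derivative_iff intro: tendsto_mono)
    then have "\<forall>\<^sub>F r in at_left s. D - e < (support_fun (Y r) (n s) - support_fun (Y s) (n s)) / (r - s)"
      using e by (intro order_tendstoD) auto
    then show "\<forall>\<^sub>F r in at_left s. norm (n s) - norm (n r) \<le> (C + 1) * norm (n s) * (s - r)"
      using growth[OF sT(1) ns e D_ge, simplified] ev[OF s]
    proof eventually_elim
      case (elim r)
      have "(D - e) * (s - r) \<le> support_fun (Y s) (n s) - support_fun (Y r) (n s)"
      proof -
        have "support_fun (Y r) (n s) - support_fun (Y s) (n s) < (D - e) * (r - s)"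
          using elim(1,3) by (subst (asm) neg_less_divide_eq) auto
        then show ?thesis by (simp add: algebra_simps)
      qed
      then have "norm (n s) * (norm (n s) - norm (n r)) \<le> (C * (norm (n s))\<^sup>2 + 2 * e) * (s - r)"
        using elim(2) by (simp add: algebra_simps)
      also have "\<dots> = norm (n s) * ((C + 1) * norm (n s) * (s - r))"
        by (simp add: e_def power2_eq_square algebra_simps)
      finally show ?case using pos by (simp add: mult_le_cancel_left_pos)
    qed
  qed (use ab N C in auto)
  then have "x b = p b" by (simp add: n_def)
  then show ?thesis using p_in[OF ab(2)] by simp
qed

end

theorem theorem2:
  fixes f :: "real^'nx \<Rightarrow> real^'nw \<Rightarrow> real^'nx"
    and G :: "real^'nx \<Rightarrow> real^'nu^'nx"
    and U :: "(real^'nu) set"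
    and W :: "(real^'nw) set"
    and Y :: "real \<Rightarrow> (real^'nx) set"
    and t1 t2 :: real
  assumes "t1 \<le> t2"
    and "compact U" and "convex U" and "interior U \<noteq> {}"
    and "compact W" and "convex W" and "W \<noteq> {}"
    and "continuous_on UNIV (\<lambda>(x, w). f x w)"
    and "local_lipschitz UNIV UNIV (\<lambda>w x. f x w)"
    and "continuously_differentiable G"
    and "\<And>t. t \<in> {t1..t2} \<Longrightarrow> compact (Y t) \<and> convex (Y t) \<and> Y t \<noteq> {}"
    and "\<And>c. \<exists>L. L-lipschitz_on {t1..t2} (\<lambda>t. support_fun (Y t) c)"
    and "min_max_differential_inequality (control_affine f G) U W t1 t2 Y"
  shows "robust_forward_invariant_tube (control_affine f G) U W t1 t2 Y"
proof -
  have "U \<noteq> {}" using \<open>interior U \<noteq> {}\<close> interior_subset by blast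
  then interpret tube_system f G U W Y t1 t2
    using assms by unfold_locales auto
  show ?thesis
    unfolding robust_forward_invariant_tube_def
    using feedback_law invariant by (auto simp: disturbances_def)
qed

end
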